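(* Let $f$ be a linear isometry of the Euclidean space $\mathbb{O}$ with $f(1)=1$ such that the algebra $\mathbb{O}^f$ contains no $4$-dimensional subalgebras, and let $B=(\mathbb{O}^f)_*$. Then: (1) $B$ contains a $2$-dimensional subalgebra but no $4$-dimensional subalgebras; as a consequence, $B$ has degree $8$. (2) $B$ satisfies the identity $(x^2,y,x^2)=0$ (for all $x,y\in B$) but does not satisfy the identity $(x,x^2,x)=0$.
   Context: An algebra is a vector space with a bilinear (not necessarily associative or unital) product; the associator is $(x,y,z)=(xy)z-x(yz)$, and $x^2=xx$, computed in the algebra concerned. $\mathbb{O}$ is the real octonion algebra with unit $1$, standard involution $x\mapsto\overline{x}$ and Euclidean norm. For a linear isometry $f$ of $\mathbb{O}$ fixing $1$, $\mathbb{O}^f$ is the normed space $\mathbb{O}$ with product $x\bullet y=f(x)f(y)$; it is an absolute-valued algebra (i.e. $\|x\bullet y\|=\|x\|\,\|y\|$) and the map $*:\alpha 1+u\mapsto\alpha 1-u$ ($\alpha\in\mathbb{R}$, $u\in \mathrm{Im}(\mathbb{O})$), which is just $x\mapsto\overline{x}$, is an involution of $\mathbb{O}^f$. The algebra $(\mathbb{O}^f)_*$ is the normed space $\mathbb{O}$ with product $x\odot y=x^*\bullet y=f(\overline{x})f(y)$. Isometries $f$ fixing $1$ for which $\mathbb{O}^f$ has no $4$-dimensional subalgebras are known to exist. A finite-dimensional algebra has degree $n$ if $n$ is the minimum natural number such that all single-generated subalgebras have dimension $\le n$. *)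

theory Defs
  imports "HOL-Analysis.Analysis"
begin

text \<open>
  A (not necessarily associative or unital) real algebra is a real vector space together with a
  product given explicitly as a function, so that several products can live on the same space.
\<close>

definition subalgebra :: "('a::real_vector \<Rightarrow> 'a \<Rightarrow> 'a) \<Rightarrow> 'a set \<Rightarrow> bool" where
  "subalgebra m S \<longleftrightarrow> subspace S \<and> (\<forall>x\<in>S. \<forall>y\<in>S. m x y \<in> S)"

definition generated_subalgebra :: "('a::real_vector \<Rightarrow> 'a \<Rightarrow> 'a) \<Rightarrow> 'a \<Rightarrow> 'a set" where
  "generated_subalgebra m x = subalgebra m hull {x}"

definition has_degree :: "('a::euclidean_space \<Rightarrow> 'a \<Rightarrow> 'a) \<Rightarrow> nat \<Rightarrow> bool" where
  "has_degree m n \<longleftrightarrow>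
     (\<forall>x. dim (generated_subalgebra m x) \<le> n) \<and>
     (\<forall>k. (\<forall>x. dim (generated_subalgebra m x) \<le> k) \<longrightarrow> n \<le> k)"

definition associator :: "('a::real_vector \<Rightarrow> 'a \<Rightarrow> 'a) \<Rightarrow> 'a \<Rightarrow> 'a \<Rightarrow> 'a \<Rightarrow> 'a" where
  "associator m x y z = m (m x y) z - m x (m y z)"

definition square :: "('a \<Rightarrow> 'a \<Rightarrow> 'a) \<Rightarrow> 'a \<Rightarrow> 'a" where
  "square m x = m x x"

text \<open>
  The octonions are obtained from the complex numbers by applying the Cayley--Dickson doubling
  \<open>(a, b) (c, d) = (a c - d* b, d a + b c*)\<close>, \<open>(a, b)* = (a*, - b)\<close> twice. The product types carry
  the Euclidean inner product and norm of real 8-space.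
\<close>

type_synonym quaternion = "complex \<times> complex"
type_synonym octonion = "quaternion \<times> quaternion"

definition quat_cnj :: "quaternion \<Rightarrow> quaternion" where
  "quat_cnj x = (cnj (fst x), - snd x)"

definition quat_mult :: "quaternion \<Rightarrow> quaternion \<Rightarrow> quaternion" where
  "quat_mult x y =
     (fst x * fst y - cnj (snd y) * snd x, snd y * fst x + snd x * cnj (fst y))"

definition oct_one :: octonion where
  "oct_one = ((1, 0), (0, 0))"

definition oct_cnj :: "octonion \<Rightarrow> octonion" where
  "oct_cnj x = (quat_cnj (fst x), - snd x)"

definition oct_mult :: "octonion \<Rightarrow> octonion \<Rightarrow> octonion" where
  "oct_mult x y =
     (quat_mult (fst x) (fst y) - quat_mult (quat_cnj (snd y)) (snd x),
      quat_mult (snd y) (fst x) + quat_mult (snd x) (quat_cnj (fst y)))"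

text \<open>The products of \<open>\<O>\<^sup>f\<close> and of \<open>A\<^sub>*\<close>, for an algebra \<open>A\<close> with involution \<open>s\<close>.\<close>

definition oct_isotope :: "(octonion \<Rightarrow> octonion) \<Rightarrow> octonion \<Rightarrow> octonion \<Rightarrow> octonion" where
  "oct_isotope f x y = oct_mult (f x) (f y)"

definition star_product :: "('a \<Rightarrow> 'a \<Rightarrow> 'a) \<Rightarrow> ('a \<Rightarrow> 'a) \<Rightarrow> 'a \<Rightarrow> 'a \<Rightarrow> 'a" where
  "star_product m s x y = m (s x) y"


end

theory Submission imports Defs begin

text \<open>
  In \<open>B\<close> the square of \<open>x\<close> is \<open>\<parallel>x\<parallel>\<^sup>2 1\<close>, so \<open>(x\<^sup>2, y, x\<^sup>2) = 0\<close> reduces to \<open>x = 1\<close>, where both terms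
  are the conjugate of \<open>f (f y)\<close>. An orthogonal map of the 7-dimensional space of imaginary octonions
  has an eigenvector \<open>u\<close> with eigenvalue \<open>1\<close> or \<open>-1\<close>: it spans with \<open>1\<close> a 2-dimensional
  subalgebra, and \<open>(u, u\<^sup>2, u) \<noteq> 0\<close>.

  A nonzero subalgebra of \<open>B\<close> contains \<open>1\<close>, is stable under \<open>f\<close> and conjugation, and is therefore a
  subalgebra of both \<open>\<O>\<^sup>f\<close> and \<open>\<O>\<close>; so its dimension is not 4. A subalgebra of \<open>\<O>\<close> of
  dimension greater than 2 has dimension 4 or 8. If \<open>x\<close> is chosen with \<open>f x\<close> outside the span of
  \<open>1\<close> and \<open>x\<close>, the subalgebra of \<open>B\<close> generated by \<open>x\<close> has dimension at least 3, hence 8.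
\<close>

section \<open>Orthogonal matrices of odd size\<close>

text \<open>Since \<open>A\<close> times its transpose is 1, the determinants of
  \<open>A + c 1\<close> and \<open>1 + c A\<close> differ by the factor \<open>det A\<close>. For
  \<open>c = - det A\<close> this makes \<open>det (A + c 1)\<close> its own negative, so a kernel
  vector exists; its eigenvalue is \<open>det A\<close>.\<close>

lemma orthogonal_matrix_odd_eigenvector:
  fixes A :: "real^'n^'n"
  assumes "orthogonal_matrix A" "odd CARD('n)"
  obtains v where "v \<noteq> 0" "A *v v = v \<or> A *v v = - v"
proof -
  have AA: "A ** transpose A = mat 1"
    using assms(1) by (simp add: orthogonal_matrix_def)
  \<comment> \<open>An odd number of rows is scaled by -1.\<close>
  have minus: "det (- M) = - det M" for M :: "real^'n^'n"
  proof -
    have "- M = (\<chi> i. (-1) *s M $ i)"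
      by (vector)
    then show ?thesis
      using det_rows_mul[of "\<lambda>_. -1" "\<lambda>i. M $ i"] assms(2) by simp
  qed
  have key: "det (A + c *\<^sub>R mat 1) = det A * det (mat 1 + c *\<^sub>R A)" for c
  proof -
    have "A + c *\<^sub>R mat 1 = A ** (mat 1 + c *\<^sub>R transpose A)"
      by (simp add: matrix_add_ldistrib AA) (simp add: AA[symmetric] matrix_matrix_mult_def vec_eq_iff sum_distrib_left algebra_simps)
    moreover have "mat 1 + c *\<^sub>R transpose A = transpose (mat 1 + c *\<^sub>R A)"
      by (simp add: transpose_def mat_def vec_eq_iff)
    ultimately show ?thesis
      by (simp add: det_mul det_transpose)
  qed
  obtain c :: real where c: "c = 1 \<or> c = -1" "det (A + c *\<^sub>R mat 1) = 0"
  proof (cases "det A = 1")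
    case True
    have "mat 1 + (-1) *\<^sub>R A = - (A + (-1) *\<^sub>R mat 1)"
      by simp
    then have "det (mat 1 + (-1) *\<^sub>R A) = - det (A + (-1) *\<^sub>R mat 1)"
      using minus by presburger
    then have "det (A + (-1) *\<^sub>R mat 1) = - det (A + (-1) *\<^sub>R mat 1)"
      using key[of "-1"] True by (metis mult_1)
    then show ?thesis
      using that[of "-1"] by simp
  next
    case False
    then have "det A = -1"
      using det_orthogonal_matrix[OF assms(1)] by simp
    then show ?thesis
      using key[of 1] that[of 1] by (simp add: add.commute)
  qed
  then have "\<not> invertible (A + c *\<^sub>R mat 1)"
    by (simp add: invertible_det_nz)
  then obtain v where "v \<noteq> 0" "(A + c *\<^sub>R mat 1) *v v = 0"
    unfolding invertible_left_inverse matrix_left_invertible_ker by blast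
  then have "A *v v + c *\<^sub>R v = 0"
    by (simp add: matrix_vector_mult_add_rdistrib scaleR_matrix_vector_assoc[symmetric])
  then show thesis
    using that[of v] \<open>v \<noteq> 0\<close> c(1) eq_neg_iff_add_eq_0[of "A *v v" v] by auto
qed

section \<open>Spanned and generated subalgebras\<close>

lemma subalgebra_span:
  assumes h: "bilinear h" and G: "\<And>x y. x \<in> G \<Longrightarrow> y \<in> G \<Longrightarrow> h x y \<in> span G"
  shows "subalgebra h (span G)"
proof -
  have *: "h x y \<in> span G" if "x \<in> G" "y \<in> span G" for x y
    using that(2)
    by (induction rule: span_induct_alt)
      (use that(1) G h in \<open>auto simp: bilinear_rzero bilinear_radd bilinear_rmul intro: span_add span_scale span_zero\<close>)
  have "h x y \<in> span G" if "x \<in> span G" "y \<in> span G" for x y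
    using that(1)
    by (induction rule: span_induct_alt)
      (use that(2) * h in \<open>auto simp: bilinear_lzero bilinear_ladd bilinear_lmul intro: span_add span_scale span_zero\<close>)
  then show ?thesis
    by (simp add: subalgebra_def)
qed

lemma subalgebra_generated: "subalgebra m (generated_subalgebra m x)"
  unfolding generated_subalgebra_def
  by (rule hull_in) (auto simp: subalgebra_def intro: subspace_Inter)

lemma generator_mem: "x \<in> generated_subalgebra m x"
  unfolding generated_subalgebra_def using hull_subset by fastforce

section \<open>Octonion arithmetic\<close>

text \<open>In this form conjugation is visibly preserved by every subspace containing 1 and by
  every isometry fixing 1.\<close>

lemma oct_cnj_eq: "oct_cnj x = (2 * (x \<bullet> oct_one)) *\<^sub>R oct_one - x"
  by (cases x rule: prod.exhaust, rename_tac a b, case_tac a, case_tac b)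
    (simp add: oct_cnj_def quat_cnj_def oct_one_def complex_eq_iff)

lemmas oct_simps = oct_mult_def quat_mult_def oct_cnj_def quat_cnj_def oct_one_def
  inner_prod_def inner_complex_def prod_eq_iff complex_eq_iff

lemma linear_oct_cnj: "linear oct_cnj"
  by (rule linearI) (auto simp: oct_simps algebra_simps)

lemma bilinear_oct_mult: "bilinear oct_mult"
  unfolding bilinear_def
  by (auto intro!: linearI simp: oct_simps algebra_simps)

lemmas oct_mult_zero [simp] = bilinear_lzero[OF bilinear_oct_mult] bilinear_rzero[OF bilinear_oct_mult]

lemma oct_one_mult [simp]: "oct_mult oct_one x = x" and oct_mult_one [simp]: "oct_mult x oct_one = x"
  by (auto simp: oct_simps)

lemma oct_cnj_cnj [simp]: "oct_cnj (oct_cnj x) = x"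
  by (auto simp: oct_simps)

lemma oct_cnj_one [simp]: "oct_cnj oct_one = oct_one"
  by (auto simp: oct_simps)

lemma oct_one_nonzero [simp]: "oct_one \<noteq> 0"
  by (auto simp: oct_simps)

lemma inner_oct_one_one [simp]: "oct_one \<bullet> oct_one = 1"
  by (auto simp: oct_simps)

lemma oct_cnj_mult_self: "oct_mult (oct_cnj x) x = (x \<bullet> x) *\<^sub>R oct_one"
  by (auto simp: oct_simps algebra_simps)

lemma oct_mult_cnj_self: "oct_mult x (oct_cnj x) = (x \<bullet> x) *\<^sub>R oct_one"
  by (auto simp: oct_simps algebra_simps)

lemma inner_oct_mult_left: "oct_mult x y \<bullet> z = y \<bullet> oct_mult (oct_cnj x) z"
  by (simp add: oct_simps algebra_simps)

lemma inner_oct_mult_right: "oct_mult x y \<bullet> z = x \<bullet> oct_mult z (oct_cnj y)"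
  by (simp add: oct_simps algebra_simps)

text \<open>This fragment of alternativity stands in for associativity: it cancels a right factor
  and so excludes zero divisors.\<close>

lemma oct_mult_mult_cnj: "oct_mult (oct_mult x y) (oct_cnj y) = (y \<bullet> y) *\<^sub>R x"
  by (simp add: oct_simps algebra_simps)

lemma oct_mult_eq_0_iff: "oct_mult x y = 0 \<longleftrightarrow> x = 0 \<or> y = 0"
  using oct_mult_mult_cnj[of x y] by auto

section \<open>Dimensions of unital subalgebras of the octonions\<close>

lemma subspace_oct_cnj:
  assumes "subspace S" "oct_one \<in> S" "x \<in> S"
  shows "oct_cnj x \<in> S"
  unfolding oct_cnj_eq using assms by (intro subspace_diff subspace_scale)

text \<open>Multiplication by a nonzero element of \<open>S\<^sup>\<bottom>\<close> embeds \<open>S\<close> into \<open>S\<^sup>\<bottom>\<close>.\<close>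

lemma oct_subalgebra_dim_le:
  assumes S: "subalgebra oct_mult S" "oct_one \<in> S" and "dim S < 8"
  shows "dim S \<le> 4"
proof -
  have sub: "subspace S" and mul: "\<And>x y. x \<in> S \<Longrightarrow> y \<in> S \<Longrightarrow> oct_mult x y \<in> S"
    using S by (auto simp: subalgebra_def)
  define T where "T = {y. \<forall>x\<in>S. orthogonal x y}"
  have "dim T + dim S = 8"
    using dim_subspace_orthogonal_to_vectors[OF sub subspace_UNIV] by (simp add: T_def)
  then have "\<not> T \<subseteq> {0}"
    using assms(3) dim_eq_0[of T] by linarith
  then obtain t where t: "t \<in> T" "t \<noteq> 0" by auto
  have lin: "linear (\<lambda>s. oct_mult s t)"
    using bilinear_oct_mult unfolding bilinear_def by blast
  have inj: "inj (\<lambda>s. oct_mult s t)"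
    using t by (auto simp: linear_injective_0[OF lin] oct_mult_eq_0_iff)
  \<comment> \<open>Moving \<open>s\<close> across the inner product turns it into a pairing of an
    element of \<open>S\<close> with \<open>t\<close>.\<close>
  have "s' \<bullet> oct_mult s t = 0" if "s \<in> S" "s' \<in> S" for s s'
  proof -
    have "oct_mult (oct_cnj s) s' \<in> S"
      using that mul subspace_oct_cnj[OF sub S(2)] by blast
    then have "oct_mult (oct_cnj s) s' \<bullet> t = 0"
      using t(1) by (simp only: T_def orthogonal_def mem_Collect_eq)
    then show ?thesis
      by (metis inner_commute inner_oct_mult_left)
  qed
  then have "(\<lambda>s. oct_mult s t) ` S \<subseteq> T"
    unfolding T_def orthogonal_def by blast
  then have "dim S \<le> dim T"
    using dim_image_eq[OF lin inj_on_subset[OF inj subset_UNIV]] dim_subset by metis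
  then show ?thesis
    using \<open>dim T + dim S = 8\<close> by linarith
qed

text \<open>For \<open>u, v \<in> S\<close> with \<open>1, u, v\<close> orthogonal, \<open>u v\<close> is orthogonal to all three.\<close>

lemma oct_subalgebra_dim_ge:
  assumes S: "subalgebra oct_mult S" "oct_one \<in> S" and "dim S > 2"
  shows "dim S \<ge> 4"
proof -
  have sub: "subspace S" and mul: "\<And>x y. x \<in> S \<Longrightarrow> y \<in> S \<Longrightarrow> oct_mult x y \<in> S"
    using S by (auto simp: subalgebra_def)
  \<comment> \<open>Two vectors span less than \<open>S\<close>, whose dimension exceeds 2, so
    \<open>S\<close> has room for a vector orthogonal to both.\<close>
  have ex: "\<exists>v\<in>S. v \<noteq> 0 \<and> (\<forall>b\<in>F. orthogonal v b)" if "F \<subseteq> S" "finite F" "card F \<le> 2" for F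
  proof -
    have "span F \<subset> span S"
      using that assms(3) dim_le_card'[of F] dim_span[of F] dim_span[of S] span_mono[of F S] by fastforce
    then obtain v where "v \<noteq> 0" "v \<in> span S" "\<And>y. y \<in> span F \<Longrightarrow> orthogonal v y"
      using orthogonal_to_subspace_exists_gen by blast
    then show ?thesis
      using span_eq_iff[THEN iffD2, OF sub] by (auto intro!: bexI[of _ v] span_base)
  qed
  obtain u where u: "u \<in> S" "u \<noteq> 0" "u \<bullet> oct_one = 0"
    using ex[of "{oct_one}"] S by (auto simp: orthogonal_def)
  obtain v where v: "v \<in> S" "v \<noteq> 0" "v \<bullet> oct_one = 0" "v \<bullet> u = 0"
  proof -
    have "card {oct_one, u} \<le> 2"
      by (simp add: card_insert_if)
    then show ?thesis using ex[of "{oct_one, u}"] S u that by (auto simp: orthogonal_def)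
  qed
  define w where "w = oct_mult u v"
  have cnj: "oct_cnj u = - u" "oct_cnj v = - v"
    using u v by (auto simp: oct_cnj_eq)
  \<comment> \<open>Moving one factor of \<open>u v\<close> to the other side reduces the three
    inner products to multiples of \<open>v \<bullet> u\<close>, \<open>v \<bullet> oct_one\<close>
    and \<open>u \<bullet> oct_one\<close>, all zero.\<close>
  have w: "w \<in> S" "w \<noteq> 0" "w \<bullet> oct_one = 0" "w \<bullet> u = 0" "w \<bullet> v = 0"
    using u v mul
    by (auto simp: w_def oct_mult_eq_0_iff)
      (simp_all add: inner_oct_mult_left[of u v oct_one] cnj inner_oct_mult_left[of u v u]
        oct_cnj_mult_self[of u, unfolded cnj] inner_oct_mult_right[of u v v]
        oct_mult_cnj_self[of v, unfolded cnj])
  let ?F = "{oct_one, u, v, w}"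
  have "pairwise orthogonal ?F"
    using u v w by (auto simp: pairwise_def orthogonal_def inner_commute)
  then have "independent ?F"
    using u v w by (intro pairwise_orthogonal_independent) auto
  moreover have "card ?F = 4"
    using u v w by (auto simp: card_insert_if)
  moreover have "?F \<subseteq> S"
    using u v w S by auto
  ultimately show ?thesis
    using independent_card_le_dim by metis
qed

lemma dim_quaternions: "dim {x :: octonion. snd x = 0} = 4"
proof -
  have lin: "linear (\<lambda>q :: quaternion. (q, 0) :: octonion)"
    by (auto intro!: linearI)
  have "{x :: octonion. snd x = 0} = (\<lambda>q. (q, 0)) ` UNIV"
    by (auto simp: image_iff)
  then show ?thesis
    using dim_image_eq[OF lin] by (auto simp: inj_def)
qed

section \<open>Isometries fixing 1 and the product of \<open>B\<close>\<close>

locale oct_isometry =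
  fixes f :: "octonion \<Rightarrow> octonion"
  assumes lin: "linear f" and norm_f: "norm (f x) = norm x" and f_one: "f oct_one = oct_one"
begin

abbreviation B :: "octonion \<Rightarrow> octonion \<Rightarrow> octonion" where
  "B \<equiv> star_product (oct_isotope f) oct_cnj"

lemma inner_f: "f x \<bullet> f y = x \<bullet> y"
proof -
  have "orthogonal_transformation f"
    unfolding orthogonal_transformation using lin norm_f by blast
  then show ?thesis
    unfolding orthogonal_transformation_def by blast
qed

text \<open>Conjugation is determined by 1 and the inner product, and \<open>f\<close> preserves
  both.\<close>

lemma f_cnj: "f (oct_cnj x) = oct_cnj (f x)"
  using inner_f[of x oct_one]
  by (simp add: oct_cnj_eq linear_diff[OF lin] linear_scale[OF lin] f_one)

lemma B_eq: "B x y = oct_mult (oct_cnj (f x)) (f y)"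
  by (simp add: star_product_def oct_isotope_def f_cnj)

lemma square_B: "square B x = (x \<bullet> x) *\<^sub>R oct_one"
  by (simp add: square_def B_eq oct_cnj_mult_self inner_f)

lemma B_one_left: "B oct_one x = f x"
  using B_eq[of oct_one x] by (simp add: f_one)

lemma B_one_right: "B x oct_one = oct_cnj (f x)"
  using B_eq[of x oct_one] by (simp add: f_one)

lemma bilinear_B: "bilinear B"
  unfolding bilinear_def B_eq
proof (intro conjI allI)
  fix x
  have 1: "linear (oct_mult z)" and 2: "linear (\<lambda>y. oct_mult y z)" for z
    using bilinear_oct_mult unfolding bilinear_def by blast+
  show "linear (\<lambda>y. oct_mult (oct_cnj (f x)) (f y))"
    using linear_compose[OF lin 1] by (simp add: o_def)
  show "linear (\<lambda>y. oct_mult (oct_cnj (f y)) (f x))"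
    using linear_compose[OF linear_compose[OF lin linear_oct_cnj] 2] by (simp add: o_def)
qed

section \<open>Subalgebras of \<open>B\<close>\<close>

text \<open>The square of a nonzero element is a positive multiple of 1.\<close>

lemma B_one_mem:
  assumes "subalgebra B S" "x \<in> S" "x \<noteq> 0"
  shows "oct_one \<in> S"
proof -
  have "square B x \<in> S"
    using assms by (auto simp: subalgebra_def square_def)
  then have "(1 / (x \<bullet> x)) *\<^sub>R ((x \<bullet> x) *\<^sub>R oct_one) \<in> S"
    using assms unfolding square_B subalgebra_def by (blast intro: subspace_scale)
  then show ?thesis
    using assms(3) by simp
qed

lemma B_subalgebra_f:
  assumes "subalgebra B S" "oct_one \<in> S" "x \<in> S"
  shows "f x \<in> S"
  using assms B_one_left[of x] by (metis subalgebra_def)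

text \<open>Conjugating the left factor turns the product of \<open>B\<close> back into that of the
  isotope, and \<open>S\<close> is stable under conjugation because it contains 1.\<close>

lemma B_subalgebra_isotope:
  assumes S: "subalgebra B S" "oct_one \<in> S"
  shows "subalgebra (oct_isotope f) S"
  unfolding subalgebra_def
proof (intro conjI ballI)
  show sub: "subspace S"
    using S by (simp add: subalgebra_def)
  fix x y assume "x \<in> S" "y \<in> S"
  then have "B (oct_cnj x) y \<in> S"
    using S subspace_oct_cnj[OF sub] by (auto simp: subalgebra_def)
  then show "oct_isotope f x y \<in> S"
    by (simp add: star_product_def)
qed

text \<open>An \<open>f\<close>-stable subspace is mapped onto itself, so the twist by \<open>f\<close> can be undone.\<close>

lemma B_subalgebra_oct:
  assumes S: "subalgebra B S" "oct_one \<in> S"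
  shows "subalgebra oct_mult S"
proof -
  have sub: "subspace S"
    using S by (simp add: subalgebra_def)
  have "inj f"
    using norm_f by (metis linear_injective_0 lin norm_eq_zero)
  then have "dim (f ` S) = dim S"
    using dim_image_eq[OF lin] inj_on_subset by blast
  then have "f ` S = S"
    using B_subalgebra_f[OF S] sub linear_subspace_image[OF lin sub]
    by (intro subspace_dim_equal) auto
  moreover have "oct_mult (f x) (f y) \<in> S" if "x \<in> S" "y \<in> S" for x y
    using B_subalgebra_isotope[OF S] that by (auto simp: subalgebra_def oct_isotope_def)
  ultimately show ?thesis
    using sub unfolding subalgebra_def by (metis imageE)
qed

section \<open>Eigenvectors of \<open>f\<close> and their consequences\<close>

lemma imaginary_eigenvector:
  obtains u where "u \<noteq> 0" "u \<bullet> oct_one = 0" "f u = u \<or> f u = - u"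
proof -
  define V where "V = {x. oct_one \<bullet> x = 0}"
  have "subspace V"
    unfolding V_def by (rule subspace_hyperplane)
  moreover have "dim V = dim (UNIV :: (real^7) set)"
    unfolding V_def by (simp add: dim_hyperplane)
  \<comment> \<open>\<open>g\<close> and \<open>h\<close> are inverse isometries between the
    imaginary octonions and \<open>real^7\<close>; conjugating \<open>f\<close> by them gives an
    orthogonal map in odd dimension, whose eigenvectors \<open>h\<close> carries back.\<close>
  ultimately obtain g :: "octonion \<Rightarrow> real^7" and h where gh: "linear g" "linear h" "g ` V = UNIV"
    "h ` UNIV = V" "\<And>x. x \<in> V \<Longrightarrow> norm (g x) = norm x" "\<And>x. norm (h x) = norm x"
    "\<And>x. x \<in> V \<Longrightarrow> h (g x) = x" "\<And>x. g (h x) = x"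
    using isometries_subspaces[of V "UNIV :: (real^7) set"] subspace_UNIV by (metis UNIV_I)
  have fV: "f x \<in> V" if "x \<in> V" for x
    using that inner_f[of oct_one x] by (simp add: V_def f_one)
  define k where "k = g \<circ> f \<circ> h"
  have k: "linear k"
    unfolding k_def using gh lin by (intro linear_compose)
  have hV: "h x \<in> V" for x
    using gh by auto
  have "orthogonal_transformation k"
    using k gh norm_f fV hV by (auto simp: orthogonal_transformation k_def)
  then have "orthogonal_matrix (matrix k)"
    by (simp add: orthogonal_transformation_matrix)
  then obtain v where v: "v \<noteq> 0" "matrix k *v v = v \<or> matrix k *v v = - v"
    by (rule orthogonal_matrix_odd_eigenvector) simp_all
  then have "k v = v \<or> k v = - v"
    using matrix_vector_mul(2)[OF k] by metis
  then have "h (k v) = h v \<or> h (k v) = - h v"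
    using linear_neg[OF gh(2)] by auto
  then have "f (h v) = h v \<or> f (h v) = - h v"
    using gh fV hV by (auto simp: k_def)
  moreover have "h v \<noteq> 0"
    using v gh by (metis norm_eq_zero)
  ultimately show thesis
    using that[of "h v"] hV[of v] by (auto simp: V_def inner_commute)
qed

lemma B_two_dim_subalgebra: "\<exists>S. subalgebra B S \<and> dim S = 2"
proof -
  obtain u where u: "u \<noteq> 0" "u \<bullet> oct_one = 0" "f u = u \<or> f u = - u"
    by (rule imaginary_eigenvector)
  let ?S = "span {oct_one, u}"
  have sub: "subspace ?S" and one: "oct_one \<in> ?S" and uS: "u \<in> ?S"
    by (auto intro: span_base)
  have fu: "f u \<in> ?S"
    using u uS span_neg by auto
  \<comment> \<open>The only product of generators without a factor 1.\<close>
  have "oct_mult (oct_cnj (f u)) (f u) \<in> ?S"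
    unfolding oct_cnj_mult_self using one by (rule span_scale)
  then have "B x y \<in> ?S" if "x \<in> {oct_one, u}" "y \<in> {oct_one, u}" for x y
    using that one fu subspace_oct_cnj[OF sub one fu]
    by (auto simp: B_eq f_one)
  then have "subalgebra B ?S"
    using bilinear_B by (intro subalgebra_span)
  moreover have "independent {oct_one, u}"
    using u by (intro pairwise_orthogonal_independent)
      (auto simp: pairwise_def orthogonal_def inner_commute)
  then have "dim ?S = 2"
    using u dim_eq_card_independent[of "{oct_one, u}"] by (auto simp: card_insert_if)
  ultimately show ?thesis by blast
qed

lemma B_associator_square: "associator B (square B x) y (square B x) = 0"
proof -
  have "B (B oct_one y) oct_one = B oct_one (B y oct_one)"
    by (simp add: B_one_left B_one_right f_cnj)
  then show ?thesis
    by (simp add: associator_def square_B bilinear_lmul[OF bilinear_B] bilinear_rmul[OF bilinear_B])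
qed

lemma B_associator_nonzero: "\<exists>x. associator B x (square B x) x \<noteq> 0"
proof -
  obtain u where u: "u \<noteq> 0" "u \<bullet> oct_one = 0" "f u = u \<or> f u = - u"
    by (rule imaginary_eigenvector)
  have cnj: "oct_cnj u = - u"
    using u by (simp add: oct_cnj_eq)
  have uu: "oct_mult u u = - ((u \<bullet> u) *\<^sub>R oct_one)"
    using oct_cnj_mult_self[of u] by (simp add: cnj bilinear_lneg[OF bilinear_oct_mult] minus_equation_iff[of "oct_mult u u"])
  \<comment> \<open>The scalar \<open>c\<close> treats both signs at once.\<close>
  obtain c :: real where c: "c \<noteq> 0" "f u = c *\<^sub>R u"
    using u(3) by (metis scaleR_one scaleR_minus1_left zero_neq_one zero_neq_neg_one)
  have "associator B u (square B u) u = (u \<bullet> u) *\<^sub>R (B (B u oct_one) u - B u (B oct_one u))"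
    by (simp add: associator_def square_B bilinear_lmul[OF bilinear_B] bilinear_rmul[OF bilinear_B]
        scaleR_diff_right)
  also have "\<dots> = (u \<bullet> u) *\<^sub>R (oct_mult (f (f u)) (f u) - oct_mult (oct_cnj (f u)) (f (f u)))"
    unfolding B_one_left B_one_right by (simp add: B_eq f_cnj)
  \<comment> \<open>The products are \<open>c^3 u u\<close> and, because of the conjugation,
    \<open>- c^3 u u\<close>; they add up instead of cancelling.\<close>
  also have "\<dots> = (u \<bullet> u) *\<^sub>R (2 * c ^ 3) *\<^sub>R oct_mult u u"
    by (simp add: c(2) cnj linear_scale[OF lin] linear_scale[OF linear_oct_cnj]
        bilinear_lmul[OF bilinear_oct_mult] bilinear_rmul[OF bilinear_oct_mult]
        bilinear_lneg[OF bilinear_oct_mult] power3_eq_cube mult.assoc flip: scaleR_2)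
  finally have "associator B u (square B u) u \<noteq> 0"
    using u(1) c(1) uu by simp
  then show ?thesis by blast
qed

section \<open>The degree of \<open>B\<close>\<close>

text \<open>Otherwise \<open>f\<close> preserves the quaternions, which then form a 4-dimensional subalgebra.\<close>

lemma ex_not_in_span:
  assumes "\<not> (\<exists>S. subalgebra (oct_isotope f) S \<and> dim S = 4)"
  obtains x where "f x \<notin> span {oct_one, x}"
proof (rule ccontr)
  assume "\<not> thesis"
  then have all: "f x \<in> span {oct_one, x}" for x
    using that by blast
  let ?H = "{x :: octonion. snd x = 0}"
  have sub: "subspace ?H"
    by (auto simp: subspace_def)
  have "f x \<in> ?H" if "x \<in> ?H" for x
  proof -
    have "span {oct_one, x} \<subseteq> ?H"
      using that sub by (intro span_minimal) (auto simp: oct_one_def zero_prod_def)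
    then show ?thesis
      using all[of x] by blast
  qed
  moreover have "oct_mult x y \<in> ?H" if "x \<in> ?H" "y \<in> ?H" for x y
    using that by (simp add: oct_simps)
  ultimately have "subalgebra (oct_isotope f) ?H"
    using sub by (auto simp: subalgebra_def oct_isotope_def)
  then show False
    using assms dim_quaternions by blast
qed

lemma B_has_degree:
  assumes "\<not> (\<exists>S. subalgebra (oct_isotope f) S \<and> dim S = 4)"
  shows "has_degree B 8"
proof -
  obtain x where x: "f x \<notin> span {oct_one, x}"
    using ex_not_in_span[OF assms] .
  let ?S = "generated_subalgebra B x"
  have S: "subalgebra B ?S" and xS: "x \<in> ?S"
    by (rule subalgebra_generated generator_mem)+
  have "x \<noteq> 0"
    using x linear_0[OF lin] by (auto simp: span_zero)
  then have one: "oct_one \<in> ?S"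
    using B_one_mem[OF S xS] by blast
  have fx: "f x \<in> ?S"
    by (rule B_subalgebra_f[OF S one xS])
  \<comment> \<open>A multiple of 1 is fixed by \<open>f\<close>, contrary to the choice of
    \<open>x\<close>.\<close>
  have xn: "x \<notin> span {oct_one}"
  proof
    assume "x \<in> span {oct_one}"
    then obtain c where "x = c *\<^sub>R oct_one" by (auto simp: span_singleton)
    then show False
      using x by (auto simp: linear_scale[OF lin] f_one intro!: span_scale span_base)
  qed
  have "independent {f x, x, oct_one}"
    using x xn by (intro independent_insertI) (simp_all add: insert_commute independent_empty)
  moreover have "card {f x, x, oct_one} = 3"
  proof -
    have "f x \<noteq> x" "f x \<noteq> oct_one" "x \<noteq> oct_one"
      using x xn by (metis insertI1 insertI2 span_base)+
    then show ?thesis by simp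
  qed
  ultimately have "3 \<le> dim ?S"
    using independent_card_le_dim[of "{f x, x, oct_one}" ?S] one xS fx by auto
  moreover have "dim ?S \<noteq> 4"
    using assms B_subalgebra_isotope[OF S one] by blast
  \<comment> \<open>Dimension at least 3 forces at least 4; 4 is excluded by hypothesis, and
    anything below 8 would be at most 4.\<close>
  ultimately have "8 \<le> dim ?S"
    using oct_subalgebra_dim_le[OF B_subalgebra_oct[OF S one] one]
      oct_subalgebra_dim_ge[OF B_subalgebra_oct[OF S one] one] by linarith
  moreover have "dim T \<le> 8" for T :: "octonion set"
    using dim_subset_UNIV[of T] by simp
  ultimately show ?thesis
    unfolding has_degree_def by (meson order_trans)
qed

end

theorem proposition4p6:
  fixes f :: "octonion \<Rightarrow> octonion" and B :: "octonion \<Rightarrow> octonion \<Rightarrow> octonion"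
  assumes "linear f"
    and "\<And>x. norm (f x) = norm x"
    and "f oct_one = oct_one"
    and "\<not> (\<exists>S. subalgebra (oct_isotope f) S \<and> dim S = 4)"
    and "B = star_product (oct_isotope f) oct_cnj"
  shows "((\<exists>S. subalgebra B S \<and> dim S = 2) \<and>
          \<not> (\<exists>S. subalgebra B S \<and> dim S = 4) \<and>
          has_degree B 8) \<and>
         ((\<forall>x y. associator B (square B x) y (square B x) = 0) \<and>
          \<not> (\<forall>x. associator B x (square B x) x = 0))"
proof -
  interpret oct_isometry f
    by (rule oct_isometry.intro) (fact assms)+
  \<comment> \<open>A 4-dimensional subalgebra is nonzero, hence contains 1 and is also a subalgebra
    of the isotope.\<close>
  have "\<not> (subalgebra B S \<and> dim S = 4)" for S
  proof
    assume S: "subalgebra B S \<and> dim S = 4"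
    then have "\<not> S \<subseteq> {0}"
      using dim_eq_0[of S] by linarith
    then have "oct_one \<in> S"
      using S B_one_mem assms(5) by blast
    then show False
      using S B_subalgebra_isotope assms(4,5) by blast
  qed
  then show ?thesis
    using B_two_dim_subalgebra B_has_degree[OF assms(4)] B_associator_square B_associator_nonzero
    unfolding assms(5) by blast
qed

end
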